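(* Let $M$ be a manifold, $D\subset M$ a bounded open set, $k\ge2$, $0<\alpha\le 1$, $0<\nu<1$, and $\nu^\alpha<\lambda<\beta<1$. Let $\Phi=\tau\ltimes(\phi_1,\dots,\phi_k)\in\mathcal S^{0,\alpha}_{k,\lambda,\beta}(D)$ be a one-step skew-product map. Assume that there exists a non-empty open set $B\subset D$ such that $$\overline B\subset \phi_1(B)\cup\dots\cup\phi_k(B).$$ Then the maximal invariant set $\Gamma_\Phi$ of $\Phi$ in $\Sigma_k\times\overline D$ is a symbolic $cs$-blender-horseshoe for $\Phi$ whose superposition domain contains $B$.
   Context: $\Sigma_k=\{1,\dots,k\}^{\mathbb Z}$ with shift $(\tau\xi)_i=\xi_{i+1}$ and metric $d_{\Sigma_k}(\xi,\zeta)=\nu^\ell$, $\ell=\min\{i\ge0:\xi_i\ne\zeta_i\text{ or }\xi_{-i}\neq\zeta_{-i}\}$ (and $0$ if $\xi=\zeta$). $\|x-y\|$ denotes the distance between $x$ and $y$ in $M$. Put $W^s_{loc}(\xi;\tau)=\{\zeta:\zeta_i=\xi_i,\ i\ge0\}$ and $W^u_{loc}(\xi;\tau)=\{\zeta:\zeta_i=\xi_i,\ i\le0\}$. A symbolic skew-product is a map $\Phi=\tau\ltimes\phi_\xi$ of $\Sigma_k\times M$, $\Phi(\xi,x)=(\tau(\xi),\phi_\xi(x))$, where the $\phi_\xi:M\to M$ are diffeomorphisms depending continuously on $\xi$. It is one-step, written $\Phi=\tau\ltimes(\phi_1,\dots,\phi_k)$, if $\phi_\xi=\phi_i$ whenever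 $\xi_0=i$. $\phi^n_\xi=\phi_{\tau^{n-1}(\xi)}\circ\cdots\circ\phi_\xi$. For $r\ge0$, $\mathcal S^{r,\alpha}_{k,\lambda,\beta}(D)$ is the set of symbolic skew-products such that: (i) each $\phi_\xi$ is $C^r$ and $\lambda\|x-y\|<\|\phi_\xi(x)-\phi_\xi(y)\|<\beta\|x-y\|$ for all $x\ne y$ in $\overline D$; (ii) there is $C\ge0$ with $\|\phi_\xi^{\pm1}(x)-\phi_\zeta^{\pm1}(x)\|\le C\,d_{\Sigma_k}(\xi,\zeta)^\alpha$ for all $x\in\overline D$ and all $\xi,\zeta$ with $\xi_0=\zeta_0$ (the smallest such $C$ is denoted $C_\Phi$); (iii) if $\beta<1$, then $\phi_\xi(\overline D)\subset D$ for all $\xi$. It carries the distance $d_{\mathcal S}(\Phi,\Psi)=\sup_\xi d_{C^r}(\phi_\xi,\psi_\xi)+|C_\Phi-C_\Psi|$ ($C^r$-distance over $\overline D$). For $\Phi\in\mathcal S^{0,\alpha}_{k,\lambda,\beta}(D)$ with $\beta<1$, $\alpha>0$, let $\Gamma_\Phi=\bigcap_{n\in\mathbb Z}\Phi^n(\Sigma_k\times\overline D)$. For $(\xi,x)\in\Gamma_\Phi$ the local strong unstable set $W^{uu}_{loc}((\xi,x);\Phi)$ is the graph of $\gamma^u_{\xi,x}:W^u_{loc}(\xi;\tau)\to M$, $\gamma^u_{\xi,x}(\xi')=\lim_{n\to\infty}\phi^n_{\tau^{-n}(\xi')}\circ(\phi^n_{\tau^{-n}(\xi)})^{-1}(x)$,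 and $W^{uu}_{loc}(\Gamma_\Phi;\Phi)=\bigcup_{(\xi,x)\in\Gamma_\Phi}W^{uu}_{loc}((\xi,x);\Phi)$. Given $\delta>0$ and a bounded open set $B\subset M$, an (almost) $\delta$-horizontal disk in $\Sigma_k\times B$ is a set $H^s=\{(\xi,h(\xi)):\xi\in W^s_{loc}(\zeta;\tau)\}$, where $(\zeta,z)\in\Sigma_k\times B$ and $h:W^s_{loc}(\zeta;\tau)\to B$ is $(\alpha,C)$-Hölder ($\|h(\xi)-h(\xi')\|\le C d_{\Sigma_k}(\xi,\xi')^\alpha$) with $C\nu^\alpha<\delta$ and $\|z-h(\xi)\|<\delta$ for all $\xi$. $\Gamma_\Phi$ is a symbolic $cs$-blender-horseshoe if there are $\delta>0$, a non-empty open set $B\subset D$ (a superposition domain), and a neighborhood $\mathcal V$ of $\Phi$ in $\mathcal S^{0,\alpha}_{k,\lambda,\beta}(D)$ such that for every $\Psi\in\mathcal V$ and every $\delta$-horizontal disk $H^s$ in $\Sigma_k\times B$ one has $W^{uu}_{loc}(\Gamma_\Psi;\Psi)\cap H^s\ne\emptyset$. *)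

theory Defs
  imports "HOL-Analysis.Analysis"
begin

text \<open>Topological manifolds of dimension \<open>n\<close>, without boundary.  Nothing smooth is assumed,
  since only the \<open>C\<^sup>0\<close> theory of skew-products is used below.\<close>

definition manifold :: "nat \<Rightarrow> 'a topology \<Rightarrow> bool" where
  "manifold n X \<longleftrightarrow>
     Hausdorff_space X \<and> second_countable X \<and>
     (\<forall>x\<in>topspace X. \<exists>U V. openin X U \<and> x \<in> U \<and> openin (Euclidean_space n) V \<and>
        subtopology X U homeomorphic_space subtopology (Euclidean_space n) V)"


subsection \<open>The full shift\<close>

definition Sigma_seq :: "nat \<Rightarrow> (int \<Rightarrow> nat) set" where
  "Sigma_seq k = {\<xi>. \<forall>i. \<xi> i \<in> {1..k}}"

text \<open>\<open>shift n\<close> is the \<open>n\<close>-th power, positive or negative, of the shift \<open>\<tau> = shift 1\<close>.\<close>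

definition shift :: "int \<Rightarrow> (int \<Rightarrow> nat) \<Rightarrow> (int \<Rightarrow> nat)" where
  "shift n \<xi> = (\<lambda>i. \<xi> (i + n))"

definition seq_dist :: "real \<Rightarrow> (int \<Rightarrow> nat) \<Rightarrow> (int \<Rightarrow> nat) \<Rightarrow> real" where
  "seq_dist \<nu> \<xi> \<zeta> =
     (if \<xi> = \<zeta> then 0
      else \<nu> ^ (LEAST i::nat. \<xi> (int i) \<noteq> \<zeta> (int i) \<or> \<xi> (- int i) \<noteq> \<zeta> (- int i)))"

definition Ws_loc :: "nat \<Rightarrow> (int \<Rightarrow> nat) \<Rightarrow> (int \<Rightarrow> nat) set" where
  "Ws_loc k \<xi> = {\<zeta> \<in> Sigma_seq k. \<forall>i\<ge>0. \<zeta> i = \<xi> i}"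

definition Wu_loc :: "nat \<Rightarrow> (int \<Rightarrow> nat) \<Rightarrow> (int \<Rightarrow> nat) set" where
  "Wu_loc k \<xi> = {\<zeta> \<in> Sigma_seq k. \<forall>i\<le>0. \<zeta> i = \<xi> i}"


subsection \<open>Symbolic skew-products\<close>

text \<open>A skew-product is represented by its family of fibre maps \<open>\<phi>\<close>; only the values of \<open>\<phi>\<close> on
  \<^term>\<open>Sigma_seq k\<close> matter.\<close>

definition skew :: "((int \<Rightarrow> nat) \<Rightarrow> 'm \<Rightarrow> 'm) \<Rightarrow> (int \<Rightarrow> nat) \<times> 'm \<Rightarrow> (int \<Rightarrow> nat) \<times> 'm" where
  "skew \<phi> = (\<lambda>(\<xi>, x). (shift 1 \<xi>, \<phi> \<xi> x))"

text \<open>The fibre maps are \<open>C\<^sup>0\<close>-diffeomorphisms, i.e. homeomorphisms, of the whole manifold.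
  Joint continuity expresses continuous dependence on \<open>\<xi>\<close> in the compact-open topology (manifolds
  are locally compact); the product topology on sequences is the one induced by \<^const>\<open>seq_dist\<close>
  for \<open>0 < \<nu> < 1\<close>.\<close>

definition skew_product ::
    "nat \<Rightarrow> ((int \<Rightarrow> nat) \<Rightarrow> 'm::topological_space \<Rightarrow> 'm) \<Rightarrow> bool" where
  "skew_product k \<phi> \<longleftrightarrow>
     (\<forall>\<xi>\<in>Sigma_seq k. homeomorphism UNIV UNIV (\<phi> \<xi>) (inv (\<phi> \<xi>))) \<and>
     continuous_on (Sigma_seq k \<times> UNIV) (\<lambda>(\<xi>, x). \<phi> \<xi> x)"

definition one_step ::
    "nat \<Rightarrow> ((int \<Rightarrow> nat) \<Rightarrow> 'm \<Rightarrow> 'm) \<Rightarrow> (nat \<Rightarrow> 'm \<Rightarrow> 'm) \<Rightarrow> bool" where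
  "one_step k \<phi> f \<longleftrightarrow> (\<forall>\<xi>\<in>Sigma_seq k. \<phi> \<xi> = f (\<xi> 0))"

primrec fibre_iter ::
    "((int \<Rightarrow> nat) \<Rightarrow> 'm \<Rightarrow> 'm) \<Rightarrow> nat \<Rightarrow> (int \<Rightarrow> nat) \<Rightarrow> 'm \<Rightarrow> 'm" where
  "fibre_iter \<phi> 0 \<xi> = id"
| "fibre_iter \<phi> (Suc n) \<xi> = \<phi> (shift (int n) \<xi>) \<circ> fibre_iter \<phi> n \<xi>"

definition holder_bound ::
    "nat \<Rightarrow> real \<Rightarrow> real \<Rightarrow> 'm::metric_space set \<Rightarrow> ((int \<Rightarrow> nat) \<Rightarrow> 'm \<Rightarrow> 'm) \<Rightarrow> real \<Rightarrow> bool" where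
  "holder_bound k \<nu> \<alpha> D \<phi> C \<longleftrightarrow>
     0 \<le> C \<and>
     (\<forall>x\<in>closure D. \<forall>\<xi>\<in>Sigma_seq k. \<forall>\<zeta>\<in>Sigma_seq k. \<xi> 0 = \<zeta> 0 \<longrightarrow>
        dist (\<phi> \<xi> x) (\<phi> \<zeta> x) \<le> C * seq_dist \<nu> \<xi> \<zeta> powr \<alpha> \<and>
        dist (inv (\<phi> \<xi>) x) (inv (\<phi> \<zeta>) x) \<le> C * seq_dist \<nu> \<xi> \<zeta> powr \<alpha>)"

definition holder_const ::
    "nat \<Rightarrow> real \<Rightarrow> real \<Rightarrow> 'm::metric_space set \<Rightarrow> ((int \<Rightarrow> nat) \<Rightarrow> 'm \<Rightarrow> 'm) \<Rightarrow> real" where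
  "holder_const k \<nu> \<alpha> D \<phi> = (LEAST C. holder_bound k \<nu> \<alpha> D \<phi> C)"

text \<open>The class \<open>S\<^bsub>k,lam,\<beta>\<^esub>\<^bsup>0,\<alpha>\<^esup>(D)\<close> and its distance.\<close>

definition skew_class ::
    "nat \<Rightarrow> real \<Rightarrow> real \<Rightarrow> real \<Rightarrow> real \<Rightarrow> 'm::metric_space set
      \<Rightarrow> ((int \<Rightarrow> nat) \<Rightarrow> 'm \<Rightarrow> 'm) set" where
  "skew_class k \<nu> \<alpha> lam \<beta> D =
     {\<phi>. skew_product k \<phi> \<and>
        (\<forall>\<xi>\<in>Sigma_seq k. \<forall>x\<in>closure D. \<forall>y\<in>closure D. x \<noteq> y \<longrightarrow>
           lam * dist x y < dist (\<phi> \<xi> x) (\<phi> \<xi> y) \<and>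
           dist (\<phi> \<xi> x) (\<phi> \<xi> y) < \<beta> * dist x y) \<and>
        (\<exists>C. holder_bound k \<nu> \<alpha> D \<phi> C) \<and>
        (\<beta> < 1 \<longrightarrow> (\<forall>\<xi>\<in>Sigma_seq k. \<phi> \<xi> ` closure D \<subseteq> D))}"

definition skew_dist ::
    "nat \<Rightarrow> real \<Rightarrow> real \<Rightarrow> 'm::metric_space set
      \<Rightarrow> ((int \<Rightarrow> nat) \<Rightarrow> 'm \<Rightarrow> 'm) \<Rightarrow> ((int \<Rightarrow> nat) \<Rightarrow> 'm \<Rightarrow> 'm) \<Rightarrow> real" where
  "skew_dist k \<nu> \<alpha> D \<phi> \<psi> =
     (SUP \<xi>\<in>Sigma_seq k. SUP x\<in>closure D. dist (\<phi> \<xi> x) (\<psi> \<xi> x)) +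
     \<bar>holder_const k \<nu> \<alpha> D \<phi> - holder_const k \<nu> \<alpha> D \<psi>\<bar>"


subsection \<open>Blender-horseshoes\<close>

text \<open>Intersection over all integer powers; the negative powers are preimages, as the skew-product
  is a bijection of \<open>Sigma_seq k \<times> UNIV\<close>.\<close>

definition max_inv_set ::
    "nat \<Rightarrow> 'm::topological_space set \<Rightarrow> ((int \<Rightarrow> nat) \<Rightarrow> 'm \<Rightarrow> 'm) \<Rightarrow> ((int \<Rightarrow> nat) \<times> 'm) set" where
  "max_inv_set k D \<phi> =
     (\<Inter>n. (skew \<phi> ^^ n) ` (Sigma_seq k \<times> closure D)) \<inter>
     (\<Inter>n. (skew \<phi> ^^ n) -` (Sigma_seq k \<times> closure D))"

text \<open>The graph of the limit function \<open>\<gamma>\<^sup>u\<close>, given as a relation so that no value is assigned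
  where the limit fails to exist.\<close>

definition Wuu_loc ::
    "nat \<Rightarrow> ((int \<Rightarrow> nat) \<Rightarrow> 'm::topological_space \<Rightarrow> 'm) \<Rightarrow> (int \<Rightarrow> nat) \<times> 'm
      \<Rightarrow> ((int \<Rightarrow> nat) \<times> 'm) set" where
  "Wuu_loc k \<phi> = (\<lambda>(\<xi>, x).
     {(\<xi>', y). \<xi>' \<in> Wu_loc k \<xi> \<and>
        (\<lambda>n. fibre_iter \<phi> n (shift (- int n) \<xi>')
               (inv (fibre_iter \<phi> n (shift (- int n) \<xi>)) x)) \<longlonglongrightarrow> y})"

definition Wuu_loc_set ::
    "nat \<Rightarrow> 'm::topological_space set \<Rightarrow> ((int \<Rightarrow> nat) \<Rightarrow> 'm \<Rightarrow> 'm)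
      \<Rightarrow> ((int \<Rightarrow> nat) \<times> 'm) set" where
  "Wuu_loc_set k D \<phi> = (\<Union>p\<in>max_inv_set k D \<phi>. Wuu_loc k \<phi> p)"

definition horizontal_disk ::
    "nat \<Rightarrow> real \<Rightarrow> real \<Rightarrow> real \<Rightarrow> 'm::metric_space set \<Rightarrow> ((int \<Rightarrow> nat) \<times> 'm) set \<Rightarrow> bool" where
  "horizontal_disk k \<nu> \<alpha> \<delta> B H \<longleftrightarrow>
     (\<exists>\<zeta>\<in>Sigma_seq k. \<exists>z\<in>B. \<exists>h C.
        h ` Ws_loc k \<zeta> \<subseteq> B \<and>
        0 \<le> C \<and> C * \<nu> powr \<alpha> < \<delta> \<and>
        (\<forall>\<xi>\<in>Ws_loc k \<zeta>. \<forall>\<xi>'\<in>Ws_loc k \<zeta>.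
           dist (h \<xi>) (h \<xi>') \<le> C * seq_dist \<nu> \<xi> \<xi>' powr \<alpha>) \<and>
        (\<forall>\<xi>\<in>Ws_loc k \<zeta>. dist z (h \<xi>) < \<delta>) \<and>
        H = (\<lambda>\<xi>. (\<xi>, h \<xi>)) ` Ws_loc k \<zeta>)"

text \<open>The neighbourhood of \<open>\<phi>\<close> in the definition is taken to be an \<open>\<epsilon>\<close>-ball of \<^const>\<open>skew_dist\<close>.\<close>

definition superposition_domain ::
    "nat \<Rightarrow> real \<Rightarrow> real \<Rightarrow> real \<Rightarrow> real \<Rightarrow> 'm::metric_space set
      \<Rightarrow> ((int \<Rightarrow> nat) \<Rightarrow> 'm \<Rightarrow> 'm) \<Rightarrow> 'm set \<Rightarrow> bool" where
  "superposition_domain k \<nu> \<alpha> lam \<beta> D \<phi> B \<longleftrightarrow>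
     open B \<and> B \<noteq> {} \<and> B \<subseteq> D \<and>
     (\<exists>\<delta>>0. \<exists>\<epsilon>>0. \<forall>\<psi>\<in>skew_class k \<nu> \<alpha> lam \<beta> D. skew_dist k \<nu> \<alpha> D \<phi> \<psi> < \<epsilon> \<longrightarrow>
        (\<forall>H. horizontal_disk k \<nu> \<alpha> \<delta> B H \<longrightarrow> Wuu_loc_set k D \<psi> \<inter> H \<noteq> {}))"

definition cs_blender_horseshoe ::
    "nat \<Rightarrow> real \<Rightarrow> real \<Rightarrow> real \<Rightarrow> real \<Rightarrow> 'm::metric_space set
      \<Rightarrow> ((int \<Rightarrow> nat) \<Rightarrow> 'm \<Rightarrow> 'm) \<Rightarrow> ((int \<Rightarrow> nat) \<times> 'm) set \<Rightarrow> bool" where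
  "cs_blender_horseshoe k \<nu> \<alpha> lam \<beta> D \<phi> \<Gamma> \<longleftrightarrow>
     \<phi> \<in> skew_class k \<nu> \<alpha> lam \<beta> D \<and> \<Gamma> = max_inv_set k D \<phi> \<and>
     (\<exists>B. superposition_domain k \<nu> \<alpha> lam \<beta> D \<phi> B)"

end

theory Submission
  imports Defs
begin

text \<open>The set \<open>\<Gamma>\<^sub>\<psi>\<close> contains every point with a backward orbit in \<^term>\<open>closure D\<close>, and each of its points
  lies in its own local strong unstable set.  So it suffices to find on every horizontal disk over
  \<open>W\<^sup>s\<^sub>l\<^sub>o\<^sub>c(\<zeta>)\<close> a point whose backward orbit stays in \<open>B\<close>.  The disk has diameter less than \<open>\<delta>\<close>, so it
  lies over a single piece of the covering; choosing this piece as the symbol at position \<open>-1\<close> and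
  applying the inverse skew-product gives a disk in \<open>B\<close> whose Hoelder constant has changed
  from \<open>C\<close> to at most \<open>C \<nu>\<^sup>\<alpha> / \<lambda> + C\<^sub>\<psi>\<close>.  As \<open>\<nu>\<^sup>\<alpha> < \<lambda>\<close> and \<open>C\<^sub>\<psi>\<close> is small (\<open>C\<^sub>\<phi> = 0\<close> for a one-step map),
  the bound \<open>C \<nu>\<^sup>\<alpha> < \<delta>\<close> persists and the step can be iterated.

  The metric of the manifold need not be proper, but the covering forces \<^term>\<open>closure D\<close> to be compact, which
  makes the covering of \<^term>\<open>closure B\<close> uniform and robust under \<open>C\<^sup>0\<close>-perturbations.\<close>

subsection \<open>Manifolds\<close>

text \<open>A chart carries over local compactness from an open subset of Euclidean space; a closed
  ball inside the resulting compact neighbourhood is compact.\<close>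

lemma manifold_locally_compact:
  assumes "manifold n (euclidean :: 'm::metric_space topology)"
  obtains r where "r > 0" "compact (cball (b::'m) r)"
proof -
  obtain U V where U: "open U" "b \<in> U" and V: "openin (Euclidean_space n) V"
    and UV: "subtopology euclidean U homeomorphic_space subtopology (Euclidean_space n) V"
    using assms unfolding manifold_def by (metis UNIV_I open_openin topspace_euclidean)
  have "locally_compact_space (subtopology (Euclidean_space n) V)"
    using V by (simp add: Hausdorff_Euclidean_space locally_compact_Euclidean_space
        locally_compact_space_open_subset)
  then have "locally_compact_space (top_of_set U)"
    using UV homeomorphic_locally_compact_space by blast
  then obtain W K where W: "openin (top_of_set U) W" "compactin (top_of_set U) K" "b \<in> W" "W \<subseteq> K"
    using U by (auto simp: locally_compact_space_def)
  then have "open W" "compact K"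
    using U openin_open_trans by (auto simp: compactin_subtopology)
  then obtain r where r: "r > 0" "cball b r \<subseteq> W"
    using W by (meson open_contains_cball)
  then have "compact (cball b r)"
    using \<open>compact K\<close> W by (metis closed_cball compact_Int_closed inf.absorb_iff2 order_trans)
  then show ?thesis using r that by blast
qed

text \<open>Charts again. Small connected neighbourhoods will stand in for balls, which need not be
  connected in an arbitrary metric.\<close>

lemma manifold_locally_connected:
  assumes "manifold n (euclidean :: 'm::metric_space topology)" and "open W" "(x::'m) \<in> W"
  obtains U where "open U" "connected U" "x \<in> U" "U \<subseteq> W"
proof -
  obtain U V where U: "open U" "x \<in> U" and V: "openin (Euclidean_space n) V"
    and UV: "subtopology euclidean U homeomorphic_space subtopology (Euclidean_space n) V"
    using assms unfolding manifold_def by (metis UNIV_I open_openin topspace_euclidean)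
  have "locally_connected_space (subtopology (Euclidean_space n) V)"
    using V by (simp add: locally_connected_Euclidean_space locally_connected_space_open_subset)
  then have "locally_connected_space (top_of_set U)"
    using UV homeomorphic_locally_connected_space by blast
  moreover have "openin (top_of_set U) (U \<inter> W)"
    using assms by (simp add: openin_open_Int)
  ultimately obtain V where "openin (top_of_set U) V" "connectedin (top_of_set U) V"
      "x \<in> V" "V \<subseteq> U \<inter> W"
    using U assms unfolding locally_connected_space by (metis IntI)
  then show ?thesis
    using U that openin_open_trans by (metis connectedin_subtopology connectedin_iff_connected inf.boundedE)
qed


subsection \<open>Compactness of the closure of the domain\<close>

text \<open>Every point of \<open>B\<close> has a preimage in \<open>B\<close> under some
  \<open>f i\<close>, so preimages can be chosen \<open>N\<close> times in succession;
  \<open>F\<close> is the composition of the maps used. Generalising over \<open>b\<close> lets the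
  induction pass to the preimage.\<close>

lemma iterated_covering_maps:
  fixes f :: "'i \<Rightarrow> 'm::metric_space \<Rightarrow> 'm"
  assumes hom: "\<And>i. i \<in> I \<Longrightarrow> homeomorphism UNIV UNIV (f i) (inv (f i))"
    and inv: "\<And>i. i \<in> I \<Longrightarrow> f i ` K \<subseteq> K"
    and contr: "\<And>i x y. i \<in> I \<Longrightarrow> x \<in> K \<Longrightarrow> y \<in> K \<Longrightarrow> dist (f i x) (f i y) \<le> \<beta> * dist x y"
    and cover: "B \<subseteq> (\<Union>i\<in>I. f i ` B)" and "0 \<le> \<beta>" and "b \<in> B"
  shows "\<exists>F G. homeomorphism UNIV UNIV F G \<and> b \<in> F ` B \<and> F ` K \<subseteq> K \<and>
           (\<forall>x\<in>K. \<forall>y\<in>K. dist (F x) (F y) \<le> \<beta> ^ N * dist x y)"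
  using \<open>b \<in> B\<close>
proof (induction N arbitrary: b)
  case 0
  then show ?case
    by (intro exI[of _ id]) (auto simp: homeomorphism_def)
next
  case (Suc N)
  obtain i b' where i: "i \<in> I" "b' \<in> B" "b = f i b'"
    using cover Suc.prems by blast
  obtain F G where F: "homeomorphism UNIV UNIV F G" "b' \<in> F ` B" "F ` K \<subseteq> K"
      "\<forall>x\<in>K. \<forall>y\<in>K. dist (F x) (F y) \<le> \<beta> ^ N * dist x y"
    using Suc.IH i by blast
  have "dist (f i (F x)) (f i (F y)) \<le> \<beta> ^ Suc N * dist x y" if "x \<in> K" "y \<in> K" for x y
  proof -
    have "dist (f i (F x)) (f i (F y)) \<le> \<beta> * dist (F x) (F y)"
      using contr[OF i(1)] F that by blast
    also have "\<dots> \<le> \<beta> * (\<beta> ^ N * dist x y)"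
      using F that \<open>0 \<le> \<beta>\<close> by (intro mult_left_mono) auto
    finally show ?thesis by (simp add: mult.assoc)
  qed
  moreover have "homeomorphism UNIV UNIV (f i \<circ> F) (G \<circ> inv (f i))"
    using homeomorphism_compose F hom i by blast
  moreover have "b \<in> (f i \<circ> F) ` B"
    using i F(2) by auto
  moreover have "(f i \<circ> F) ` K \<subseteq> K"
    using F(3) inv[OF i(1)] unfolding image_comp[symmetric] by blast
  ultimately show ?case
    by (metis comp_apply)
qed

text \<open>A long word of the fibre maps embeds \<open>K\<close> as a closed subset of a small compact ball around a
  point of \<open>B\<close>.\<close>

lemma compact_if_covered_by_contractions:
  fixes f :: "'i \<Rightarrow> 'm::metric_space \<Rightarrow> 'm"
  assumes hom: "\<And>i. i \<in> I \<Longrightarrow> homeomorphism UNIV UNIV (f i) (inv (f i))"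
    and inv: "\<And>i. i \<in> I \<Longrightarrow> f i ` K \<subseteq> K"
    and contr: "\<And>i x y. i \<in> I \<Longrightarrow> x \<in> K \<Longrightarrow> y \<in> K \<Longrightarrow> dist (f i x) (f i y) \<le> \<beta> * dist x y"
    and cover: "B \<subseteq> (\<Union>i\<in>I. f i ` B)" and \<beta>: "0 \<le> \<beta>" "\<beta> < 1"
    and K: "closed K" "bounded K" "B \<subseteq> K"
    and b: "b \<in> B" and r: "r > 0" "compact (cball b r)"
  shows "compact K"
proof -
  obtain M where M: "\<And>x y. x \<in> K \<Longrightarrow> y \<in> K \<Longrightarrow> dist x y \<le> M"
    using K by (auto simp: bounded_two_points)
  have "M \<ge> 0"
    using M[of b b] b K by auto
  \<comment> \<open>The word length \<open>N\<close> is chosen so that the contracted diameter of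
    \<open>K\<close> drops below \<open>r\<close>.\<close>
  have "(\<lambda>N. \<beta> ^ N * M) \<longlonglongrightarrow> 0 * M"
    using \<beta> by (intro tendsto_intros LIMSEQ_realpow_zero)
  then have "\<forall>\<^sub>F N in sequentially. \<beta> ^ N * M < r"
    using r by (simp add: order_tendsto_iff)
  then obtain N where N: "\<beta> ^ N * M < r"
    by (auto simp: eventually_sequentially)
  have "\<exists>F G. homeomorphism UNIV UNIV F G \<and> b \<in> F ` B \<and> F ` K \<subseteq> K \<and>
      (\<forall>x\<in>K. \<forall>y\<in>K. dist (F x) (F y) \<le> \<beta> ^ N * dist x y)"
    by (intro iterated_covering_maps[where f = f and I = I and K = K and \<beta> = \<beta> and B = B and b = b]
        hom inv contr cover \<beta>(1) b)
  then obtain F G where F: "homeomorphism UNIV UNIV F G" "b \<in> F ` B" "F ` K \<subseteq> K"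
      "\<forall>x\<in>K. \<forall>y\<in>K. dist (F x) (F y) \<le> \<beta> ^ N * dist x y"
    by blast
  obtain c where c: "c \<in> B" "b = F c" using F by blast
  have "F ` K \<subseteq> cball b r"
  proof clarsimp
    fix x assume "x \<in> K"
    then have "dist (F c) (F x) \<le> \<beta> ^ N * dist c x"
      using F c K by blast
    also have "\<dots> \<le> \<beta> ^ N * M"
      using M[of c x] c K \<open>x \<in> K\<close> \<beta> by (intro mult_left_mono) auto
    finally show "dist b (F x) \<le> r" using N c by simp
  qed
  moreover have "closed (F ` K)"
    using homeomorphism_imp_closed_map[OF F(1), of K] K by simp
  ultimately have "compact (F ` K)"
    using r by (metis compact_Int_closed inf.absorb_iff2)
  then have "compact (G ` F ` K)"
    using compact_continuous_image[of "F ` K" G] homeomorphism_cont2[OF F(1)] continuous_on_subset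
    by blast
  moreover have "G ` F ` K = K"
    using homeomorphism_apply1[OF F(1)] by (simp add: image_image)
  ultimately show ?thesis by simp
qed


subsection \<open>Robustness of the covering\<close>

text \<open>A connected set that meets the open set \<open>g ` B\<close> but not \<open>g ` frontier B\<close> lies in \<open>g ` B\<close>;
  this replaces a degree argument.\<close>

lemma robust_covering:
  fixes f :: "nat \<Rightarrow> 'm::metric_space \<Rightarrow> 'm"
  assumes M: "manifold n (euclidean :: 'm topology)"
    and hom: "\<And>i. i \<in> I \<Longrightarrow> homeomorphism UNIV UNIV (f i) (inv (f i))"
    and B: "open B" "compact (closure B)" and cover: "closure B \<subseteq> (\<Union>i\<in>I. f i ` B)"
  shows "\<exists>\<delta>>0. \<forall>z\<in>closure B. \<exists>i\<in>I. \<forall>g. homeomorphism UNIV UNIV g (inv g) \<longrightarrow>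
      (\<forall>x\<in>closure B. dist (f i x) (g x) < \<delta>) \<longrightarrow> ball z \<delta> \<subseteq> g ` B"
proof -
  have opn: "open (g ` U)" if "homeomorphism UNIV UNIV g h" "open U" for g h :: "'m \<Rightarrow> 'm" and U
    using homeomorphism_imp_open_map[OF that(1), of U] that(2) by simp
  have "open V" if "V \<in> (\<lambda>i. f i ` B) ` I" for V
    using that opn[OF hom B(1)] by blast
  then obtain L where L: "L > 0" "\<And>z. z \<in> closure B \<Longrightarrow> \<exists>V \<in> (\<lambda>i. f i ` B) ` I. ball z L \<subseteq> V"
    using Heine_Borel_lemma[OF B(2) cover] by metis
  \<comment> \<open>Distances within a piece stay below half the Lebesgue number \<open>L\<close>;
    the other half is left for the perturbation.\<close>
  define \<G> where "\<G> = {U::'m set. open U \<and> connected U \<and> (\<forall>x\<in>U. \<forall>y\<in>U. dist x y < L / 2)}"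
  have "closure B \<subseteq> \<Union>\<G>"
  proof
    fix x :: 'm
    obtain U where U: "open U" "connected U" "x \<in> U" "U \<subseteq> ball x (L / 4)"
      using manifold_locally_connected[OF M, of "ball x (L / 4)" x] L by auto
    have "dist y z < L / 2" if "y \<in> U" "z \<in> U" for y z
    proof -
      have "dist x y < L / 4" "dist x z < L / 4" using U that by auto
      then show ?thesis using dist_triangle3[of y z x] by linarith
    qed
    then show "x \<in> \<Union>\<G>" using U unfolding \<G>_def by blast
  qed
  then obtain e where e: "e > 0" "\<And>z. z \<in> closure B \<Longrightarrow> \<exists>U\<in>\<G>. ball z e \<subseteq> U"
    by (rule Heine_Borel_lemma[OF B(2)]) (auto simp: \<G>_def)
  \<comment> \<open>\<open>e\<close> keeps the ball about \<open>z\<close> inside one connected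
    piece; \<open>L / 2\<close> limits the displacement between \<open>f i\<close> and
    \<open>g\<close>.\<close>
  define \<delta> where "\<delta> = min e (L / 2)"
  show ?thesis
  proof (intro exI[of _ \<delta>] conjI ballI)
    show "\<delta> > 0" using e L by (simp add: \<delta>_def)
  next
    fix z assume z: "z \<in> closure B"
    obtain i where i: "i \<in> I" "ball z L \<subseteq> f i ` B" using L z by blast
    obtain U where U: "U \<in> \<G>" "ball z e \<subseteq> U" using e z by blast
    have zU: "z \<in> U" using U e by auto
    have inj: "inj (f i)"
      using hom[OF i(1)] by (metis homeomorphism_def injI UNIV_I)
    show "\<exists>i\<in>I. \<forall>g. homeomorphism UNIV UNIV g (inv g) \<longrightarrow>
        (\<forall>x\<in>closure B. dist (f i x) (g x) < \<delta>) \<longrightarrow> ball z \<delta> \<subseteq> g ` B"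
    proof (intro bexI[OF _ i(1)] allI impI)
      fix g assume g: "homeomorphism UNIV UNIV g (inv g)"
        and near: "\<forall>x\<in>closure B. dist (f i x) (g x) < \<delta>"
      have "closed (g ` closure B)"
        using homeomorphism_imp_closed_map[OF g, of "closure B"] by simp
      then have "closure (g ` B) \<subseteq> g ` closure B"
        by (meson closure_minimal closure_subset image_mono)
      then have fr: "frontier (g ` B) \<subseteq> g ` (closure B - B)"
        using opn[OF g B(1)] by (auto simp: frontier_def interior_open)
      \<comment> \<open>If \<open>g c\<close> lay in \<open>U\<close> for a boundary point
        \<open>c\<close> of \<open>B\<close>, then \<open>f i c\<close> would be within
        \<open>L\<close> of \<open>z\<close>, hence in the image of \<open>B\<close> under
        \<open>f i\<close>, against injectivity.\<close>
      have "U \<inter> frontier (g ` B) = {}"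
      proof (rule ccontr)
        assume "U \<inter> frontier (g ` B) \<noteq> {}"
        then obtain c where c: "c \<in> closure B" "c \<notin> B" "g c \<in> U" using fr by blast
        have "dist z (g c) < L / 2" using U zU c by (auto simp: \<G>_def)
        moreover have "dist (g c) (f i c) < L / 2"
          using near c by (auto simp: \<delta>_def dist_commute)
        ultimately have "f i c \<in> ball z L"
          using dist_triangle[of z "f i c" "g c"] by simp
        then have "f i c \<in> f i ` B" using i by blast
        then show False using inj c by (simp add: inj_image_mem_iff)
      qed
      \<comment> \<open>The preimage of \<open>z\<close> under \<open>f i\<close> lies in
        \<open>B\<close>, and \<open>g\<close> sends it close enough to \<open>z\<close> to land in
        \<open>U\<close>.\<close>
      moreover obtain b where b: "b \<in> B" "z = f i b"
        using i L by (metis centre_in_ball imageE subsetD)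
      then have "dist z (g b) < e" using near closure_subset by (fastforce simp: \<delta>_def)
      then have "g b \<in> U" using U by auto
      then have "U \<inter> g ` B \<noteq> {}" using b by blast
      ultimately have "U \<subseteq> g ` B"
        using connected_Int_frontier[of U "g ` B"] U by (auto simp: \<G>_def)
      moreover have "ball z \<delta> \<subseteq> ball z e" by (auto simp: \<delta>_def)
      ultimately show "ball z \<delta> \<subseteq> g ` B" using U by blast
    qed
  qed
qed


subsection \<open>The shift on local stable sets\<close>

lemma shift_in_Sigma_seq: "\<xi> \<in> Sigma_seq k \<Longrightarrow> shift m \<xi> \<in> Sigma_seq k"
  by (auto simp: Sigma_seq_def shift_def)

lemma shift_shift: "shift m (shift l \<xi>) = shift (m + l) \<xi>"
  by (auto simp: shift_def algebra_simps)

lemma shift_0 [simp]: "shift 0 \<xi> = \<xi>"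
  by (simp add: shift_def)

lemma seq_dist_nonneg: "0 \<le> \<nu> \<Longrightarrow> 0 \<le> seq_dist \<nu> \<xi> \<zeta>"
  by (simp add: seq_dist_def)

text \<open>Sequences in one local stable set differ only at negative positions, and
  \<open>shift 1\<close> moves each difference one place further from 0. This is the source of the
  factor \<nu> powr \<alpha> that competes with \<open>lam\<close>.\<close>

lemma seq_dist_shift_Ws_loc:
  assumes "\<xi> \<in> Ws_loc k \<zeta>" "\<xi>' \<in> Ws_loc k \<zeta>"
  shows "seq_dist \<nu> (shift 1 \<xi>) (shift 1 \<xi>') = \<nu> * seq_dist \<nu> \<xi> \<xi>'"
proof (cases "\<xi> = \<xi>'")
  case False
  have agree: "\<xi> i = \<xi>' i" if "i \<ge> 0" for i
    using assms that by (auto simp: Ws_loc_def)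
  have shift_neq: "shift 1 \<xi> \<noteq> shift 1 \<xi>'"
    using False by (metis shift_shift shift_0 add.left_inverse)
  let ?P = "\<lambda>i::nat. shift 1 \<xi> (int i) \<noteq> shift 1 \<xi>' (int i) \<or> shift 1 \<xi> (- int i) \<noteq> shift 1 \<xi>' (- int i)"
  let ?Q = "\<lambda>i::nat. \<xi> (int i) \<noteq> \<xi>' (int i) \<or> \<xi> (- int i) \<noteq> \<xi>' (- int i)"
  have PQ: "?P (Suc i) = ?Q i" for i
    using agree[of "int i"] agree[of "int (Suc i) + 1"] by (simp add: shift_def)
  obtain j where "\<xi> j \<noteq> \<xi>' j" using False by blast
  then have "?Q (nat (- j))" using agree[of j] by (cases "j \<ge> 0") auto
  then have "?P (Suc (nat (- j)))" using PQ by blast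
  moreover have "\<not> ?P 0" using agree[of 1] by (simp add: shift_def)
  ultimately have "(LEAST i. ?P i) = Suc (LEAST i. ?P (Suc i))"
    by (rule Least_Suc)
  then have "(LEAST i. ?P i) = Suc (LEAST i. ?Q i)"
    by (simp only: PQ)
  then show ?thesis
    using False shift_neq by (simp add: seq_dist_def)
qed (simp add: seq_dist_def)

lemma seq_dist_Ws_loc_le:
  assumes "\<xi> \<in> Ws_loc k \<zeta>" "\<xi>' \<in> Ws_loc k \<zeta>" "0 \<le> \<nu>" "\<nu> \<le> 1"
  shows "seq_dist \<nu> \<xi> \<xi>' \<le> \<nu>"
proof (cases "\<xi> = \<xi>'")
  case False
  let ?Q = "\<lambda>i::nat. \<xi> (int i) \<noteq> \<xi>' (int i) \<or> \<xi> (- int i) \<noteq> \<xi>' (- int i)"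
  obtain j where "\<xi> j \<noteq> \<xi>' j" using False by blast
  then have "?Q (nat \<bar>j\<bar>)" by (cases "j \<ge> 0") auto
  then have *: "?Q (LEAST i. ?Q i)" by (rule LeastI)
  define m where "m = (LEAST i. ?Q i)"
  have "?Q m" using * unfolding m_def .
  moreover have "\<xi> 0 = \<xi>' 0" using assms by (simp add: Ws_loc_def)
  ultimately have "m \<noteq> 0" by (intro notI) simp
  then have "\<nu> ^ m \<le> \<nu> ^ 1"
    using assms by (intro power_decreasing) auto
  then show ?thesis using False by (simp add: seq_dist_def m_def)
qed (use assms in \<open>simp add: seq_dist_def\<close>)


subsection \<open>Graph transform\<close>

text \<open>Base sequence and function are arguments because the graph transform updates both. The
  value \<open>h \<zeta>\<close> will serve as the centre of the disk.\<close>

definition holder_disk ::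
    "nat \<Rightarrow> real \<Rightarrow> real \<Rightarrow> real \<Rightarrow> 'm::metric_space set \<Rightarrow> (int \<Rightarrow> nat)
      \<Rightarrow> ((int \<Rightarrow> nat) \<Rightarrow> 'm) \<Rightarrow> bool" where
  "holder_disk k \<nu> \<alpha> \<delta> B \<zeta> h \<longleftrightarrow>
     h ` Ws_loc k \<zeta> \<subseteq> B \<and>
     (\<exists>C\<ge>0. C * \<nu> powr \<alpha> < \<delta> \<and>
        (\<forall>\<xi>\<in>Ws_loc k \<zeta>. \<forall>\<xi>'\<in>Ws_loc k \<zeta>. dist (h \<xi>) (h \<xi>') \<le> C * seq_dist \<nu> \<xi> \<xi>' powr \<alpha>))"

lemma skew_class_homeomorphism:
  "\<psi> \<in> skew_class k \<nu> \<alpha> lam \<beta> D \<Longrightarrow> \<xi> \<in> Sigma_seq k \<Longrightarrow> homeomorphism UNIV UNIV (\<psi> \<xi>) (inv (\<psi> \<xi>))"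
  by (auto simp: skew_class_def skew_product_def)

lemma skew_class_surj:
  "\<psi> \<in> skew_class k \<nu> \<alpha> lam \<beta> D \<Longrightarrow> \<xi> \<in> Sigma_seq k \<Longrightarrow> surj (\<psi> \<xi>)"
  using skew_class_homeomorphism by (fastforce simp: homeomorphism_def)

lemma skew_class_inv_f:
  assumes "\<psi> \<in> skew_class k \<nu> \<alpha> lam \<beta> D" "\<xi> \<in> Sigma_seq k"
  shows "inv (\<psi> \<xi>) (\<psi> \<xi> x) = x"
  using skew_class_homeomorphism[OF assms] by (simp add: homeomorphism_def)

lemma skew_class_image_subset:
  "\<psi> \<in> skew_class k \<nu> \<alpha> lam \<beta> D \<Longrightarrow> \<xi> \<in> Sigma_seq k \<Longrightarrow> \<beta> < 1 \<Longrightarrow> \<psi> \<xi> ` closure D \<subseteq> D"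
  by (simp add: skew_class_def)

text \<open>One step of the graph transform. The symbol from \<open>cover\<close> must work for all
  \<eta> carrying it, since the fibre map varies along the disk. By \<open>small\<close>, the
  increase of the Hoelder constant due to \<open>C'\<close> fits into the room left by \<nu> powr
  \<alpha> / \<open>lam\<close> < 1.\<close>

lemma holder_disk_backward:
  fixes \<psi> :: "(int \<Rightarrow> nat) \<Rightarrow> 'm::metric_space \<Rightarrow> 'm"
  assumes \<psi>: "\<psi> \<in> skew_class k \<nu> \<alpha> lam \<beta> D" and C': "holder_bound k \<nu> \<alpha> D \<psi> C'"
    and \<nu>: "0 < \<nu>" "\<nu> < 1" "0 < \<alpha>" "\<nu> powr \<alpha> < lam"
    and small: "C' * \<nu> powr \<alpha> \<le> (1 - \<nu> powr \<alpha> / lam) * \<delta>"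
    and BD: "B \<subseteq> D"
    and cover: "\<And>z. z \<in> B \<Longrightarrow>
      \<exists>i\<in>{1..k}. \<forall>\<eta>\<in>Sigma_seq k. \<eta> 0 = i \<longrightarrow> ball z \<delta> \<subseteq> \<psi> \<eta> ` B"
    and \<zeta>: "\<zeta> \<in> Sigma_seq k" and h: "holder_disk k \<nu> \<alpha> \<delta> B \<zeta> h"
  obtains i where "i \<in> {1..k}"
    "holder_disk k \<nu> \<alpha> \<delta> B ((shift (-1) \<zeta>)(0 := i)) (\<lambda>\<eta>. inv (\<psi> \<eta>) (h (shift 1 \<eta>)))"
proof -
  obtain C where C: "0 \<le> C" "C * \<nu> powr \<alpha> < \<delta>"
    "\<And>\<xi> \<xi>'. \<xi> \<in> Ws_loc k \<zeta> \<Longrightarrow> \<xi>' \<in> Ws_loc k \<zeta> \<Longrightarrow> dist (h \<xi>) (h \<xi>') \<le> C * seq_dist \<nu> \<xi> \<xi>' powr \<alpha>"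
    and hB: "h ` Ws_loc k \<zeta> \<subseteq> B"
    using h by (auto simp: holder_disk_def)
  have \<zeta>_Ws: "\<zeta> \<in> Ws_loc k \<zeta>" using \<zeta> by (simp add: Ws_loc_def)
  obtain i where i: "i \<in> {1..k}"
    "\<And>\<eta>. \<eta> \<in> Sigma_seq k \<Longrightarrow> \<eta> 0 = i \<Longrightarrow> ball (h \<zeta>) \<delta> \<subseteq> \<psi> \<eta> ` B"
    using cover[of "h \<zeta>"] hB \<zeta>_Ws by blast
  \<comment> \<open>The new symbol is at position 0 here, which is position -1 as seen from the old
    disk; \<open>shift 1\<close> thus maps the new local stable set into the old one.\<close>
  define \<zeta>' where "\<zeta>' = (shift (-1) \<zeta>)(0 := i)"
  have Ws': "\<eta> \<in> Sigma_seq k" "\<eta> 0 = i" "shift 1 \<eta> \<in> Ws_loc k \<zeta>" if "\<eta> \<in> Ws_loc k \<zeta>'" for \<eta>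
    using that by (auto simp: Ws_loc_def \<zeta>'_def shift_def Sigma_seq_def)
  have near: "dist (h \<zeta>) (h \<xi>) < \<delta>" if "\<xi> \<in> Ws_loc k \<zeta>" for \<xi>
  proof -
    have "dist (h \<zeta>) (h \<xi>) \<le> C * seq_dist \<nu> \<zeta> \<xi> powr \<alpha>"
      by (rule C(3)[OF \<zeta>_Ws that])
    also have "\<dots> \<le> C * \<nu> powr \<alpha>"
      using C(1) \<nu> seq_dist_Ws_loc_le[OF \<zeta>_Ws that, of \<nu>] seq_dist_nonneg[of \<nu>]
      by (intro mult_left_mono powr_mono2) auto
    finally show ?thesis using C(2) by simp
  qed
  have inB: "inv (\<psi> \<eta>) (h \<xi>) \<in> B" if "\<eta> \<in> Ws_loc k \<zeta>'" "\<xi> \<in> Ws_loc k \<zeta>" for \<eta> \<xi>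
  proof -
    have "h \<xi> \<in> \<psi> \<eta> ` B"
      using i(2)[of \<eta>] Ws'(1,2)[OF that(1)] near[OF that(2)] by auto
    then show ?thesis using skew_class_inv_f[OF \<psi> Ws'(1)[OF that(1)]] by auto
  qed
  have lam: "0 < lam" using \<nu> by (meson powr_ge_zero le_less_trans)
  let ?h = "\<lambda>\<eta>. inv (\<psi> \<eta>) (h (shift 1 \<eta>))"
  let ?C = "C * \<nu> powr \<alpha> / lam + C'"
  have "dist (?h \<eta>) (?h \<eta>') \<le> ?C * seq_dist \<nu> \<eta> \<eta>' powr \<alpha>"
    if \<eta>: "\<eta> \<in> Ws_loc k \<zeta>'" and \<eta>': "\<eta>' \<in> Ws_loc k \<zeta>'" for \<eta> \<eta>'
  proof -
    let ?d = "seq_dist \<nu> \<eta> \<eta>' powr \<alpha>"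
    let ?a = "h (shift 1 \<eta>)" and ?b = "h (shift 1 \<eta>')"
    have aD: "inv (\<psi> \<eta>) ?a \<in> closure D" and bD: "inv (\<psi> \<eta>) ?b \<in> closure D"
      using inB[OF \<eta> Ws'(3)[OF \<eta>]] inB[OF \<eta> Ws'(3)[OF \<eta>']] BD closure_subset[of D] by auto
    have ab: "\<psi> \<eta> (inv (\<psi> \<eta>) x) = x" for x
      using skew_class_surj[OF \<psi> Ws'(1)[OF \<eta>]] by (simp add: surj_f_inv_f)
    \<comment> \<open>First the point varies under one fixed inverse map, whose Lipschitz constant
      is at most 1 / \<open>lam\<close> here. Both preimages lie in \<open>B\<close> because
      \<open>inB\<close> admits unrelated \<eta> and \<xi>.\<close>
    have "lam * dist (inv (\<psi> \<eta>) ?a) (inv (\<psi> \<eta>) ?b) \<le> dist ?a ?b"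
    proof (cases "inv (\<psi> \<eta>) ?a = inv (\<psi> \<eta>) ?b")
      case False
      then have "lam * dist (inv (\<psi> \<eta>) ?a) (inv (\<psi> \<eta>) ?b)
          < dist (\<psi> \<eta> (inv (\<psi> \<eta>) ?a)) (\<psi> \<eta> (inv (\<psi> \<eta>) ?b))"
        using \<psi> Ws'(1)[OF \<eta>] aD bD unfolding skew_class_def by simp
      then show ?thesis by (simp add: ab)
    qed simp
    also have "\<dots> \<le> C * seq_dist \<nu> (shift 1 \<eta>) (shift 1 \<eta>') powr \<alpha>"
      by (rule C(3)[OF Ws'(3)[OF \<eta>] Ws'(3)[OF \<eta>']])
    also have "\<dots> = C * \<nu> powr \<alpha> * ?d"
      using seq_dist_shift_Ws_loc[OF \<eta> \<eta>'] seq_dist_nonneg[of \<nu>] \<nu> by (simp add: powr_mult)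
    finally have 1: "dist (inv (\<psi> \<eta>) ?a) (inv (\<psi> \<eta>) ?b) \<le> C * \<nu> powr \<alpha> / lam * ?d"
      using lam by (simp add: field_simps)
    \<comment> \<open>Next the point is fixed and the inverse map varies, at the cost of
      \<open>C'\<close>.\<close>
    have "?b \<in> B"
      using hB Ws'(3)[OF \<eta>'] by (rule image_subset_iff[THEN iffD1, rule_format])
    then have "?b \<in> closure D"
      using BD closure_subset by blast
    moreover have "\<eta> 0 = \<eta>' 0"
      using Ws'(2)[OF \<eta>] Ws'(2)[OF \<eta>'] by simp
    ultimately have 2: "dist (inv (\<psi> \<eta>) ?b) (inv (\<psi> \<eta>') ?b) \<le> C' * ?d"
      using C' Ws'(1)[OF \<eta>] Ws'(1)[OF \<eta>'] unfolding holder_bound_def by simp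
    have "dist (?h \<eta>) (?h \<eta>') \<le> C * \<nu> powr \<alpha> / lam * ?d + C' * ?d"
      using 1 2 dist_triangle[of "inv (\<psi> \<eta>) ?a" "inv (\<psi> \<eta>') ?b" "inv (\<psi> \<eta>) ?b"] by linarith
    then show ?thesis by (simp add: algebra_simps)
  qed
  moreover have "?C \<ge> 0"
    using C lam C' by (simp add: holder_bound_def)
  moreover have "?C * \<nu> powr \<alpha> < \<delta>"
  proof -
    have "(C * \<nu> powr \<alpha>) * (\<nu> powr \<alpha> / lam) < \<delta> * (\<nu> powr \<alpha> / lam)"
      using C(2) lam \<nu> by (intro mult_strict_right_mono) auto
    moreover have "?C * \<nu> powr \<alpha> = (C * \<nu> powr \<alpha>) * (\<nu> powr \<alpha> / lam) + C' * \<nu> powr \<alpha>"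
      by (simp add: algebra_simps)
    ultimately show ?thesis using small by (simp add: algebra_simps)
  qed
  moreover have "?h ` Ws_loc k \<zeta>' \<subseteq> B"
    using inB Ws'(3) by blast
  ultimately have "holder_disk k \<nu> \<alpha> \<delta> B \<zeta>' ?h"
    unfolding holder_disk_def by (intro conjI exI[of _ ?C] ballI)
  then show ?thesis using that[OF i(1)] by (simp add: \<zeta>'_def)
qed

text \<open>The symbols chosen in successive steps form the past of \<xi>, and the orbit is obtained
  by evaluating the \<open>n\<close>-th disk at \<open>shift (- int n) \<xi>\<close>.\<close>

lemma holder_disk_backward_orbit:
  fixes \<psi> :: "(int \<Rightarrow> nat) \<Rightarrow> 'm::metric_space \<Rightarrow> 'm"
  assumes \<psi>: "\<psi> \<in> skew_class k \<nu> \<alpha> lam \<beta> D" and C': "holder_bound k \<nu> \<alpha> D \<psi> C'"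
    and \<nu>: "0 < \<nu>" "\<nu> < 1" "0 < \<alpha>" "\<nu> powr \<alpha> < lam"
    and small: "C' * \<nu> powr \<alpha> \<le> (1 - \<nu> powr \<alpha> / lam) * \<delta>"
    and BD: "B \<subseteq> D"
    and cover: "\<And>z. z \<in> B \<Longrightarrow>
      \<exists>i\<in>{1..k}. \<forall>\<eta>\<in>Sigma_seq k. \<eta> 0 = i \<longrightarrow> ball z \<delta> \<subseteq> \<psi> \<eta> ` B"
    and \<zeta>: "\<zeta> \<in> Sigma_seq k" and h: "holder_disk k \<nu> \<alpha> \<delta> B \<zeta> h"
  obtains \<xi> y where "\<xi> \<in> Ws_loc k \<zeta>" "y 0 = h \<xi>" "\<And>n. y n \<in> B"
    "\<And>n. \<psi> (shift (- int (Suc n)) \<xi>) (y (Suc n)) = y n"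
proof -
  define pull where "pull = (\<lambda>(g :: (int \<Rightarrow> nat) \<Rightarrow> 'm) \<eta>. inv (\<psi> \<eta>) (g (shift 1 \<eta>)))"
  \<comment> \<open>The clause for \<open>n = 0\<close> pins the chosen sequence of disks to the
    given one at its start. \<open>Q\<close> leaves coordinate 0 free, as that is the symbol chosen
    in the step.\<close>
  define P where "P = (\<lambda>n (\<eta>, g). \<eta> \<in> Sigma_seq k \<and> holder_disk k \<nu> \<alpha> \<delta> B \<eta> g
      \<and> (n = (0::nat) \<longrightarrow> (\<eta>, g) = (\<zeta>, h)))"
  define Q where "Q = (\<lambda>(\<eta> :: int \<Rightarrow> nat, g) (\<eta>' :: int \<Rightarrow> nat, g'). (\<forall>j. j \<noteq> 0 \<longrightarrow> \<eta>' j = \<eta> (j - 1)) \<and> g' = pull g)"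
  have "\<exists>s. \<forall>n. P n (s n) \<and> Q (s n) (s (Suc n))"
  proof (rule dependent_nat_choice)
    show "\<exists>p. P 0 p" using \<zeta> h by (auto simp: P_def)
    fix p n assume "P n p"
    then obtain \<eta> g where p: "p = (\<eta>, g)" "\<eta> \<in> Sigma_seq k" "holder_disk k \<nu> \<alpha> \<delta> B \<eta> g"
      by (auto simp: P_def)
    obtain i where i: "i \<in> {1..k}" "holder_disk k \<nu> \<alpha> \<delta> B ((shift (-1) \<eta>)(0 := i)) (pull g)"
      using holder_disk_backward[OF \<psi> C' \<nu> small BD cover p(2,3)] by (auto simp: pull_def)
    then have "P (Suc n) ((shift (-1) \<eta>)(0 := i), pull g)"
      using p(2) by (auto simp: P_def Sigma_seq_def shift_def)
    moreover have "Q p ((shift (-1) \<eta>)(0 := i), pull g)"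
      by (simp add: Q_def p shift_def)
    ultimately show "\<exists>q. P (Suc n) q \<and> Q p q" by blast
  qed
  then obtain s where s: "\<And>n. P n (s n)" "\<And>n. Q (s n) (s (Suc n))" by blast
  define Z where "Z n = fst (s n)" for n
  define G where "G n = snd (s n)" for n
  have Z: "Z n \<in> Sigma_seq k" and G: "holder_disk k \<nu> \<alpha> \<delta> B (Z n) (G n)" for n
    using s(1)[of n] by (auto simp: P_def Z_def G_def)
  have Z0: "Z 0 = \<zeta>" and G0: "G 0 = h"
    using s(1)[of 0] by (auto simp: P_def Z_def G_def)
  have ZS: "Z (Suc n) j = Z n (j - 1)" if "j \<noteq> 0" for n j
    using s(2)[of n] that by (auto simp: Q_def Z_def)
  have GS: "G (Suc n) = pull (G n)" for n
    using s(2)[of n] by (auto simp: Q_def G_def)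
  \<comment> \<open>The symbol chosen in step \<open>n\<close> is coordinate 0 of
    \<open>Z n\<close>. Later steps only move it to the right, so the non-negative half of
    \<open>Z n\<close> agrees with \<xi> read from position -n.\<close>
  define \<xi> where "\<xi> j = (if j \<ge> 0 then \<zeta> j else Z (nat (- j)) 0)" for j
  have \<xi>_Sigma: "\<xi> \<in> Sigma_seq k"
    using \<zeta> Z by (auto simp: Sigma_seq_def \<xi>_def)
  have \<xi>_Z: "\<xi> (j - int n) = Z n j" if "j \<ge> 0" for n j
    using that
  proof (induction n arbitrary: j)
    case (Suc n)
    show ?case
    proof (cases "j = 0")
      case False
      then show ?thesis using Suc.IH[of "j - 1"] Suc.prems ZS[of j n] by (simp add: algebra_simps)
    qed (simp add: \<xi>_def nat_add_distrib)
  qed (simp add: \<xi>_def Z0)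
  have Ws: "shift (- int n) \<xi> \<in> Ws_loc k (Z n)" for n
    using \<xi>_Z shift_in_Sigma_seq[OF \<xi>_Sigma, of "- int n"] by (simp add: Ws_loc_def shift_def)
  define y where "y n = G n (shift (- int n) \<xi>)" for n
  show ?thesis
  proof (rule that[of \<xi> y])
    show "\<xi> \<in> Ws_loc k \<zeta>" using Ws[of 0] Z0 by simp
    show "y 0 = h \<xi>" by (simp add: y_def G0)
    show "y n \<in> B" for n
      using G[of n] Ws[of n] by (auto simp: holder_disk_def y_def)
    show "\<psi> (shift (- int (Suc n)) \<xi>) (y (Suc n)) = y n" for n
    proof -
      have "shift 1 (shift (- int (Suc n)) \<xi>) = shift (- int n) \<xi>"
        by (simp add: shift_shift)
      then have "y (Suc n) = inv (\<psi> (shift (- int (Suc n)) \<xi>)) (y n)"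
        unfolding y_def GS pull_def by simp
      then show ?thesis
        using skew_class_surj[OF \<psi> shift_in_Sigma_seq[OF \<xi>_Sigma]] by (simp add: surj_f_inv_f)
    qed
  qed
qed


subsection \<open>The maximal invariant set and its strong unstable set\<close>

text \<open>The backward orbit handles the images; the preimages are handled by forward invariance
  of \<open>closure D\<close>, which holds as \<beta> < 1.\<close>

lemma backward_orbit_in_max_inv_set:
  assumes \<psi>: "\<psi> \<in> skew_class k \<nu> \<alpha> lam \<beta> D" and "\<beta> < 1" and \<xi>: "\<xi> \<in> Sigma_seq k"
    and y: "\<And>n. y n \<in> closure D"
    and step: "\<And>n. \<psi> (shift (- int (Suc n)) \<xi>) (y (Suc n)) = y n"
  shows "(\<xi>, y 0) \<in> max_inv_set k D \<psi>"
proof -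
  have "(skew \<psi> ^^ n) (shift (- int n) \<xi>, y n) = (\<xi>, y 0)" for n
  proof (induction n)
    case (Suc n)
    have "skew \<psi> (shift (- int (Suc n)) \<xi>, y (Suc n)) = (shift (- int n) \<xi>, y n)"
      using step[of n] by (simp add: skew_def shift_shift)
    then show ?case using Suc.IH by (simp only: funpow_Suc_right comp_apply)
  qed simp
  moreover have "(shift (- int n) \<xi>, y n) \<in> Sigma_seq k \<times> closure D" for n
    using shift_in_Sigma_seq[OF \<xi>] y by blast
  ultimately have past: "(\<xi>, y 0) \<in> (skew \<psi> ^^ n) ` (Sigma_seq k \<times> closure D)" for n
    by (metis image_eqI)
  have inv: "skew \<psi> p \<in> Sigma_seq k \<times> closure D" if "p \<in> Sigma_seq k \<times> closure D" for p
  proof -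
    have "\<psi> \<eta> ` closure D \<subseteq> closure D" if "\<eta> \<in> Sigma_seq k" for \<eta>
      using skew_class_image_subset[OF \<psi> that \<open>\<beta> < 1\<close>] closure_subset by blast
    then show ?thesis
      using that shift_in_Sigma_seq by (auto simp: skew_def)
  qed
  have "(skew \<psi> ^^ n) (\<xi>, y 0) \<in> Sigma_seq k \<times> closure D" for n
  proof (induction n)
    case 0
    then show ?case using \<xi> y by simp
  next
    case (Suc n)
    then show ?case using inv by simp
  qed
  then show ?thesis using past by (auto simp: max_inv_set_def)
qed

text \<open>For \<xi>' = \<xi> the sequence in the limit is constant: each term goes back along the
  fibre maps and forward again, and surjectivity makes \<open>inv\<close> a right inverse.\<close>

lemma in_Wuu_loc_self:
  assumes \<psi>: "\<psi> \<in> skew_class k \<nu> \<alpha> lam \<beta> D" and \<xi>: "\<xi> \<in> Sigma_seq k"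
  shows "(\<xi>, x) \<in> Wuu_loc k \<psi> (\<xi>, x)"
proof -
  have "surj (fibre_iter \<psi> n \<eta>)" if "\<eta> \<in> Sigma_seq k" for n \<eta>
  proof (induction n)
    case (Suc n)
    then show ?case
      unfolding fibre_iter.simps
      by (rule comp_surj[OF _ skew_class_surj[OF \<psi> shift_in_Sigma_seq[OF that]]])
  qed simp
  then have "fibre_iter \<psi> n (shift (- int n) \<xi>) (inv (fibre_iter \<psi> n (shift (- int n) \<xi>)) x) = x" for n
    using shift_in_Sigma_seq[OF \<xi>] by (simp add: surj_f_inv_f)
  then show ?thesis
    using \<xi> by (simp add: Wuu_loc_def Wu_loc_def)
qed


subsection \<open>Neighbourhoods in the space of skew-products\<close>

text \<open>\<open>LEAST\<close> is meaningful here because the defining inequalities are closed in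
  \<open>C\<close>, so the infimum of all bounds is itself a bound.\<close>

lemma holder_bound_holder_const:
  assumes ex: "\<exists>C. holder_bound k \<nu> \<alpha> D \<psi> C"
  shows "holder_bound k \<nu> \<alpha> D \<psi> (holder_const k \<nu> \<alpha> D \<psi>)"
proof -
  let ?S = "{C. holder_bound k \<nu> \<alpha> D \<psi> C}"
  have bdd: "bdd_below ?S" by (auto simp: holder_bound_def bdd_below_def)
  \<comment> \<open>Dividing by \<open>s\<close> passes the inequality to the infimum;
    \<open>s = 0\<close>, which occurs for equal sequences, is treated apart.\<close>
  have le: "a \<le> Inf ?S * s" if "s \<ge> 0" "\<And>C. C \<in> ?S \<Longrightarrow> a \<le> C * s" for a s :: real
  proof (cases "s = 0")
    case False
    then have "a / s \<le> Inf ?S"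
      using that ex by (intro cInf_greatest) (auto simp: field_simps)
    then show ?thesis using False that(1) by (simp add: field_simps)
  qed (use that ex in auto)
  have "0 \<le> Inf ?S"
    using ex by (intro cInf_greatest) (auto simp: holder_bound_def)
  moreover have "dist (\<psi> \<xi> x) (\<psi> \<zeta> x) \<le> Inf ?S * seq_dist \<nu> \<xi> \<zeta> powr \<alpha>"
    "dist (inv (\<psi> \<xi>) x) (inv (\<psi> \<zeta>) x) \<le> Inf ?S * seq_dist \<nu> \<xi> \<zeta> powr \<alpha>"
    if "x \<in> closure D" "\<xi> \<in> Sigma_seq k" "\<zeta> \<in> Sigma_seq k" "\<xi> 0 = \<zeta> 0" for x \<xi> \<zeta>
    by (rule le; use that in \<open>auto simp: holder_bound_def\<close>)+
  ultimately have "holder_bound k \<nu> \<alpha> D \<psi> (Inf ?S)"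
    unfolding holder_bound_def[of _ _ _ _ _ "Inf ?S"] by blast
  moreover from this have "holder_const k \<nu> \<alpha> D \<psi> = Inf ?S"
    unfolding holder_const_def by (intro Least_equality) (auto intro: cInf_lower bdd)
  ultimately show ?thesis by simp
qed

text \<open>Fibre maps with the same symbol at 0 coincide. Hence maps near \<phi> in
  \<open>skew_dist\<close> have a small Hoelder constant.\<close>

lemma holder_const_one_step:
  assumes "one_step k \<phi> f"
  shows "holder_const k \<nu> \<alpha> D \<phi> = 0"
  unfolding holder_const_def
proof (rule Least_equality)
  show "holder_bound k \<nu> \<alpha> D \<phi> 0"
    using assms by (auto simp: holder_bound_def one_step_def)
qed (auto simp: holder_bound_def)

text \<open>A real \<open>SUP\<close> dominates its members only if they are bounded above; here
  both maps send \<open>closure D\<close> into the bounded set \<open>D\<close>.\<close>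

lemma dist_le_skew_dist:
  assumes \<phi>: "\<phi> \<in> skew_class k \<nu> \<alpha> lam \<beta> D" and \<psi>: "\<psi> \<in> skew_class k \<nu> \<alpha> lam \<beta> D"
    and D: "bounded D" and "\<beta> < 1" and \<xi>: "\<xi> \<in> Sigma_seq k" and x: "x \<in> closure D"
  shows "dist (\<phi> \<xi> x) (\<psi> \<xi> x) + \<bar>holder_const k \<nu> \<alpha> D \<phi> - holder_const k \<nu> \<alpha> D \<psi>\<bar>
    \<le> skew_dist k \<nu> \<alpha> D \<phi> \<psi>"
proof -
  obtain M where M: "\<And>x y. x \<in> D \<Longrightarrow> y \<in> D \<Longrightarrow> dist x y \<le> M"
    using D unfolding bounded_two_points by blast
  have "\<phi> \<eta> u \<in> D" "\<psi> \<eta> u \<in> D" if "\<eta> \<in> Sigma_seq k" "u \<in> closure D" for \<eta> u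
    using skew_class_image_subset \<phi> \<psi> \<open>\<beta> < 1\<close> that by blast+
  then have le: "dist (\<phi> \<eta> u) (\<psi> \<eta> u) \<le> M" if "\<eta> \<in> Sigma_seq k" "u \<in> closure D" for \<eta> u
    using that M by blast
  have "dist (\<phi> \<xi> x) (\<psi> \<xi> x) \<le> (SUP u\<in>closure D. dist (\<phi> \<xi> u) (\<psi> \<xi> u))"
    using le \<xi> x by (intro cSUP_upper) (auto simp: bdd_above_def)
  also have "\<dots> \<le> (SUP \<eta>\<in>Sigma_seq k. SUP u\<in>closure D. dist (\<phi> \<eta> u) (\<psi> \<eta> u))"
  proof (rule cSUP_upper[OF \<xi>], rule bdd_aboveI2)
    show "(SUP u\<in>closure D. dist (\<phi> \<eta> u) (\<psi> \<eta> u)) \<le> M" if "\<eta> \<in> Sigma_seq k" for \<eta>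
      using le that x by (intro cSUP_least) auto
  qed
  finally show ?thesis by (simp add: skew_dist_def)
qed


theorem theorem3:
  fixes D B :: "'m::metric_space set"
    and k n :: nat
    and \<alpha> \<nu> lam \<beta> :: real
    and \<phi> :: "(int \<Rightarrow> nat) \<Rightarrow> 'm \<Rightarrow> 'm"
    and f :: "nat \<Rightarrow> 'm \<Rightarrow> 'm"
  assumes "manifold n (euclidean :: 'm topology)"
    and "open D" and "bounded D"
    and "k \<ge> 2"
    and "0 < \<alpha>" and "\<alpha> \<le> 1"
    and "0 < \<nu>" and "\<nu> < 1"
    and "\<nu> powr \<alpha> < lam" and "lam < \<beta>" and "\<beta> < 1"
    and "\<phi> \<in> skew_class k \<nu> \<alpha> lam \<beta> D"
    and "one_step k \<phi> f"
    and "open B" and "B \<noteq> {}" and "B \<subseteq> D"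
    and "closure B \<subseteq> (\<Union>i\<in>{1..k}. f i ` B)"
  shows "cs_blender_horseshoe k \<nu> \<alpha> lam \<beta> D \<phi> (max_inv_set k D \<phi>) \<and>
         (\<exists>B'. superposition_domain k \<nu> \<alpha> lam \<beta> D \<phi> B' \<and> B \<subseteq> B')"
proof -
  note M = assms(1) and \<nu> = \<open>0 < \<nu>\<close> \<open>\<nu> < 1\<close> \<open>0 < \<alpha>\<close> \<open>\<nu> powr \<alpha> < lam\<close>
    and \<phi> = \<open>\<phi> \<in> skew_class k \<nu> \<alpha> lam \<beta> D\<close> and cover = assms(17)
  have lam: "0 < lam" using \<nu> by (meson powr_ge_zero le_less_trans)
  \<comment> \<open>Constant sequences realise every \<open>f i\<close> as a fibre map, which
    transfers the class conditions to \<open>f\<close>.\<close>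
  have const: "(\<lambda>_. i) \<in> Sigma_seq k" "f i = \<phi> (\<lambda>_. i)" if "i \<in> {1..k}" for i
    using that \<open>one_step k \<phi> f\<close> by (auto simp: Sigma_seq_def one_step_def)
  have hom: "homeomorphism UNIV UNIV (f i) (inv (f i))" if "i \<in> {1..k}" for i
    using skew_class_homeomorphism[OF \<phi>] const[OF that] by simp
  have inv: "f i ` closure D \<subseteq> closure D" if "i \<in> {1..k}" for i
    using skew_class_image_subset[OF \<phi> const(1)[OF that] \<open>\<beta> < 1\<close>] const(2)[OF that] closure_subset
    by auto
  have contr: "dist (f i x) (f i y) \<le> \<beta> * dist x y"
    if "i \<in> {1..k}" "x \<in> closure D" "y \<in> closure D" for i x y
  proof (cases "x = y")
    case False
    then show ?thesis
      using \<phi> const[OF that(1)] that unfolding skew_class_def by (simp add: less_imp_le)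
  qed simp
  obtain b where "b \<in> B" using \<open>B \<noteq> {}\<close> by blast
  obtain r where "r > 0" "compact (cball b r)"
    using manifold_locally_compact[OF M] by blast
  moreover have "B \<subseteq> (\<Union>i\<in>{1..k}. f i ` B)" "B \<subseteq> closure D"
    using cover closure_subset \<open>B \<subseteq> D\<close> by blast+
  moreover have "0 \<le> \<beta>" "closed (closure D)" "bounded (closure D)"
    using lam \<open>lam < \<beta>\<close> \<open>bounded D\<close> by auto
  ultimately have "compact (closure D)"
    using hom inv contr \<open>\<beta> < 1\<close> \<open>b \<in> B\<close>
    by (intro compact_if_covered_by_contractions[where f = f and I = "{1..k}" and B = B
          and K = "closure D" and \<beta> = \<beta> and b = b and r = r])
  then have "compact (closure B)"
    using \<open>B \<subseteq> D\<close> closure_mono by (metis closed_closure compact_Int_closed inf.absorb_iff2)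
  then have "\<exists>\<delta>>0. \<forall>z\<in>closure B. \<exists>i\<in>{1..k}. \<forall>g. homeomorphism UNIV UNIV g (inv g) \<longrightarrow>
      (\<forall>x\<in>closure B. dist (f i x) (g x) < \<delta>) \<longrightarrow> ball z \<delta> \<subseteq> g ` B"
    by (intro robust_covering[where f = f and I = "{1..k}" and B = B and n = n] M hom \<open>open B\<close> cover)
  then obtain \<delta> where \<delta>: "\<delta> > 0" "\<forall>z\<in>closure B.
      \<exists>i\<in>{1..k}. \<forall>g. homeomorphism UNIV UNIV g (inv g) \<longrightarrow>
        (\<forall>x\<in>closure B. dist (f i x) (g x) < \<delta>) \<longrightarrow> ball z \<delta> \<subseteq> g ` B"
    by (elim exE conjE)
  \<comment> \<open>The first term makes the fibre maps of \<psi> admissible in the robust covering;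
    the second gives the bound on the Hoelder constant of \<psi> that the graph transform
    requires.\<close>
  define \<epsilon> where "\<epsilon> = min \<delta> ((1 - \<nu> powr \<alpha> / lam) * \<delta> / \<nu> powr \<alpha>)"
  have "\<epsilon> > 0" using \<delta>(1) \<nu> lam by (simp add: \<epsilon>_def)
  have "Wuu_loc_set k D \<psi> \<inter> H \<noteq> {}"
    if \<psi>: "\<psi> \<in> skew_class k \<nu> \<alpha> lam \<beta> D" and near: "skew_dist k \<nu> \<alpha> D \<phi> \<psi> < \<epsilon>"
      and H: "horizontal_disk k \<nu> \<alpha> \<delta> B H" for \<psi> H
  proof -
    obtain \<zeta> h where \<zeta>: "\<zeta> \<in> Sigma_seq k" and h: "holder_disk k \<nu> \<alpha> \<delta> B \<zeta> h"
      and H_eq: "H = (\<lambda>\<xi>. (\<xi>, h \<xi>)) ` Ws_loc k \<zeta>"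
      using H unfolding horizontal_disk_def holder_disk_def by blast
    let ?C = "holder_const k \<nu> \<alpha> D \<psi>"
    have C: "holder_bound k \<nu> \<alpha> D \<psi> ?C"
      using \<psi> by (intro holder_bound_holder_const) (simp add: skew_class_def)
    have close: "dist (\<phi> \<eta> x) (\<psi> \<eta> x) + \<bar>?C\<bar> < \<epsilon>" if "\<eta> \<in> Sigma_seq k" "x \<in> closure D" for \<eta> x
      using dist_le_skew_dist[OF \<phi> \<psi> \<open>bounded D\<close> \<open>\<beta> < 1\<close> that] near
        holder_const_one_step[OF \<open>one_step k \<phi> f\<close>, of \<nu> \<alpha> D] by simp
    \<comment> \<open>One point at which to evaluate \<open>close\<close> is enough to extract the
      bound on the Hoelder constant.\<close>
    have "b \<in> closure D" using \<open>b \<in> B\<close> \<open>B \<subseteq> D\<close> closure_subset by blast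
    then have "?C < \<epsilon>" using close[OF \<zeta>, of b] by (smt (verit) zero_le_dist)
    then have "?C * \<nu> powr \<alpha> \<le> (1 - \<nu> powr \<alpha> / lam) * \<delta> / \<nu> powr \<alpha> * \<nu> powr \<alpha>"
      by (intro mult_right_mono) (auto simp: \<epsilon>_def)
    then have small: "?C * \<nu> powr \<alpha> \<le> (1 - \<nu> powr \<alpha> / lam) * \<delta>"
      using \<nu> by simp
    have "\<exists>i\<in>{1..k}. \<forall>\<eta>\<in>Sigma_seq k. \<eta> 0 = i \<longrightarrow> ball z \<delta> \<subseteq> \<psi> \<eta> ` B" if "z \<in> B" for z
    proof -
      have "z \<in> closure B" using that closure_subset by blast
      then obtain i where i: "i \<in> {1..k}" "\<forall>g. homeomorphism UNIV UNIV g (inv g) \<longrightarrow>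
          (\<forall>x\<in>closure B. dist (f i x) (g x) < \<delta>) \<longrightarrow> ball z \<delta> \<subseteq> g ` B"
        by (rule bexE[OF \<delta>(2)[rule_format]])
      have "ball z \<delta> \<subseteq> \<psi> \<eta> ` B" if \<eta>: "\<eta> \<in> Sigma_seq k" "\<eta> 0 = i" for \<eta>
      proof (rule i(2)[rule_format, OF skew_class_homeomorphism[OF \<psi> \<eta>(1)]])
        fix x assume "x \<in> closure B"
        then have "x \<in> closure D" using \<open>B \<subseteq> D\<close> closure_mono by blast
        moreover have "\<phi> \<eta> = f i" using \<eta> \<open>one_step k \<phi> f\<close> by (simp add: one_step_def)
        ultimately show "dist (f i x) (\<psi> \<eta> x) < \<delta>"
          using close[OF \<eta>(1), of x] by (auto simp: \<epsilon>_def)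
      qed
      then show ?thesis using i(1) by blast
    qed
    then obtain \<xi> y where \<xi>: "\<xi> \<in> Ws_loc k \<zeta>" and y: "y 0 = h \<xi>" "\<And>n. y n \<in> B"
        "\<And>n. \<psi> (shift (- int (Suc n)) \<xi>) (y (Suc n)) = y n"
      using holder_disk_backward_orbit[OF \<psi> C \<nu> small \<open>B \<subseteq> D\<close> _ \<zeta> h] by blast
    have \<xi>_Sigma: "\<xi> \<in> Sigma_seq k" using \<xi> by (simp add: Ws_loc_def)
    have "y n \<in> closure D" for n using y(2) \<open>B \<subseteq> D\<close> closure_subset by blast
    then have "(\<xi>, h \<xi>) \<in> max_inv_set k D \<psi>"
      using backward_orbit_in_max_inv_set[OF \<psi> \<open>\<beta> < 1\<close> \<xi>_Sigma, of y] y by simp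
    then have "(\<xi>, h \<xi>) \<in> Wuu_loc_set k D \<psi>"
      using in_Wuu_loc_self[OF \<psi> \<xi>_Sigma] by (auto simp: Wuu_loc_set_def)
    then show ?thesis using \<xi> H_eq by blast
  qed
  then have "superposition_domain k \<nu> \<alpha> lam \<beta> D \<phi> B"
    using \<delta>(1) \<open>\<epsilon> > 0\<close> \<open>open B\<close> \<open>B \<noteq> {}\<close> \<open>B \<subseteq> D\<close> unfolding superposition_domain_def by blast
  then show ?thesis
    using \<phi> unfolding cs_blender_horseshoe_def by blast
qed

end
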